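(* Let $m\ge 10$ be an integer and let $q\in\mathbb{N}$ be a prime power such that $q+1=2^{m+1}-2=2(2^m-1)$. Then there exists an explicit linear binary cyclic code $B\subseteq\mathbb{F}_2^{q+1}$ with $r(B)>\frac12$ and $\delta(B)>\frac{2\sqrt q}{q+1}$.
   Context: A linear code $B\subseteq\mathbb{F}_2^{N}$ is a linear subspace; it is cyclic if $(a_0,\dots,a_{N-1})\in B$ implies $(a_{N-1},a_0,\dots,a_{N-2})\in B$. Its rate is $r(B)=\dim B/N$ and its normalized distance $\delta(B)$ is the minimum Hamming weight of a nonzero codeword divided by $N$. The word "explicit" is used informally. *)

theory Defs
  imports
    Complex_Main
    "HOL-Library.Z2"
    "HOL-Number_Theory.Prime_Powers"
    "Jordan_Normal_Form.VS_Connect"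
begin

text \<open>The field with two elements is the type \<open>bit\<close>, and the space of words of length \<open>N\<close>
  is \<open>carrier_vec N\<close>, the carrier of \<open>module_vec TYPE(bit) N\<close>.\<close>

definition linear_code :: "nat \<Rightarrow> bit vec set \<Rightarrow> bool" where
  "linear_code N B \<longleftrightarrow> VectorSpace.subspace class_ring B (module_vec TYPE(bit) N)"

definition cyclic_shift :: "'a vec \<Rightarrow> 'a vec" where
  "cyclic_shift a = vec (dim_vec a) (\<lambda>i. if i = 0 then a $ (dim_vec a - 1) else a $ (i - 1))"

definition cyclic :: "'a vec set \<Rightarrow> bool" where
  "cyclic B \<longleftrightarrow> (\<forall>a\<in>B. cyclic_shift a \<in> B)"

definition code_dim :: "nat \<Rightarrow> bit vec set \<Rightarrow> nat" where
  "code_dim N B = vectorspace.dim class_ring ((module_vec TYPE(bit) N)\<lparr>carrier := B\<rparr>)"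

definition rate :: "nat \<Rightarrow> bit vec set \<Rightarrow> real" where
  "rate N B = real (code_dim N B) / real N"

definition hamming_weight :: "'a::zero vec \<Rightarrow> nat" where
  "hamming_weight a = card {i. i < dim_vec a \<and> a $ i \<noteq> 0}"

text \<open>Meaningful only for codes with a nonzero codeword (\<open>Min\<close> of the empty set is unspecified),
  in particular for every code of positive rate.\<close>

definition min_distance :: "nat \<Rightarrow> bit vec set \<Rightarrow> nat" where
  "min_distance N B = Min (hamming_weight ` (B - {0\<^sub>v N}))"

definition normalized_distance :: "nat \<Rightarrow> bit vec set \<Rightarrow> real" where
  "normalized_distance N B = real (min_distance N B) / real N"

end

theory Submission
  imports Defs "HOL-Algebra.Algebraic_Closure_Type"
begin

hide_const (open) Divisibility.prime
no_notation fps_nth (infixl \<open>$\<close> 75)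

text \<open>Put \<open>n = 2\<^sup>m - 1\<close>, so that \<open>q + 1 = 2n\<close>, and interleave two copies of the BCH code of
  length \<open>n\<close> with zeros \<open>\<alpha>, \<dots>, \<alpha>\<^bsup>2t\<^esup>\<close>, where \<open>\<alpha>\<close> is a primitive element of the field with
  \<open>2\<^sup>m\<close> elements. The cyclic shift swaps the two copies and shifts one of them, so the code is
  cyclic. Its minimum distance is that of a single copy, at least \<open>2t + 1\<close> by the Vandermonde
  argument. The Frobenius map makes the even syndromes redundant, so each copy is cut out by \<open>t\<close>
  conditions with values in a set of size \<open>2\<^sup>m\<close>, and the dimension is at least \<open>2n - 2mt\<close>. With
  \<open>t = (2\<^bsup>m-1\<^esup> - 1) div m\<close> the dimension exceeds \<open>n\<close>, and \<open>(2t + 1)\<^sup>2 > 4q\<close> once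
  \<open>2\<^sup>m \<ge> 8m\<^sup>2 + 2m\<close>, which holds for \<open>m \<ge> 10\<close>.\<close>

section \<open>Finite fields inside an algebraically closed field\<close>

text \<open>Since \<open>k\<close> vanishes in the field, X^k - X has derivative -1, so its roots
  are simple. It splits into \<open>k\<close> linear factors, which are therefore distinct.\<close>

lemma card_roots_pow_eq_self:
  fixes k :: nat
  assumes k: "k > 1" and ch: "of_nat k = (0 :: 'a :: alg_closed_field)"
  shows "card {x :: 'a. x ^ k = x} = k"
proof -
  define p :: "'a poly" where "p = Polynomial.monom 1 k + [:0, -1:]"
  have poly_p: "poly p x = x ^ k - x" for x
    by (simp add: p_def poly_monom)
  have deg: "Polynomial.degree p = k"
    unfolding p_def using k by (subst degree_add_eq_left) (auto simp: Polynomial.degree_monom_eq)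
  have p0: "p \<noteq> 0"
    using deg k by auto
  have pd: "pderiv p = - 1"
    by (simp add: p_def pderiv_add pderiv_monom ch pderiv_pCons one_pCons)
  have simple: "count (proots p) x = 1" if x: "poly p x = 0" for x
  proof -
    obtain q where q: "p = [:- x, 1:] * q"
      using x by (auto simp: poly_eq_0_iff_dvd)
    \<comment> \<open>Evaluating the product rule at \<open>x\<close> leaves q(x) = -1, so
      \<open>x\<close> is not a root of the cofactor \<open>q\<close>.\<close>
    have "pderiv p = q + [:- x, 1:] * pderiv q"
      unfolding q by (subst pderiv_mult) (simp add: pderiv_pCons)
    then have "poly (q + [:- x, 1:] * pderiv q) x = poly (- 1) x"
      using pd by simp
    then have "poly q x \<noteq> 0"
      by simp
    moreover have "proots p = add_mset x (proots q)"
      using p0 unfolding q by (subst proots_mult) auto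
    ultimately show ?thesis
      using p0 q by (auto simp: order_root)
  qed
  obtain A where A: "size A = Polynomial.degree p"
    "p = Polynomial.smult (Polynomial.lead_coeff p) (\<Prod>x\<in>#A. [:-x, 1:])"
    using alg_closed_imp_factorization[OF p0] by blast
  have "proots p = proots (\<Prod>x\<in>#A. [:-x, 1:])"
    by (subst A(2)) (use p0 in simp)
  also have "\<dots> = A"
  proof (induction A)
    case (add x A)
    have "(\<Prod>x\<in>#A. [:-x, 1:]) \<noteq> 0"
      by (simp add: prod_mset_zero_iff image_iff)
    then have "proots ([:-x, 1:] * (\<Prod>x\<in>#A. [:-x, 1:])) = proots [:-x, 1:] + proots (\<Prod>x\<in>#A. [:-x, 1:])"
      by (intro proots_mult) auto
    then show ?case
      using add by (simp del: mult_pCons_left)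
  qed simp
  finally have pr: "proots p = A" .
  have "count A x = 1" if "x \<in># A" for x
    using that simple p0 unfolding pr[symmetric] by auto
  then have "size A = card (set_mset A)"
    by (simp add: size_multiset_overloaded_eq)
  also have "set_mset A = {x. x ^ k = x}"
    using p0 by (simp flip: pr add: poly_p)
  finally show ?thesis
    using A(1) deg by simp
qed

text \<open>The fixed points of the \<open>m\<close>-th iterate of Frobenius form a subfield with
  \<open>n + 1\<close> elements. Its unit group is cyclic, and a generator has the required
  properties.\<close>

lemma ex_primitive_element:
  assumes p: "prime CHAR('a :: alg_closed_field)" and m: "m > 0"
  defines "n \<equiv> CHAR('a) ^ m - 1"
  shows "\<exists>\<alpha> :: 'a. \<alpha> ^ n = 1 \<and> inj_on (\<lambda>j. \<alpha> ^ j) {..<n}"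
proof -
  define k where "k = CHAR('a) ^ m"
  define F where "F = {x :: 'a. x ^ k = x}"
  \<comment> \<open>The subfield \<open>F\<close> is a set rather than a type, so it is treated as a
    subfield of the record \<open>R\<close>, for which the cyclicity of the unit group is
    stated.\<close>
  define R where "R = (ring_of_type_algebra :: 'a ring)"
  have k: "k > 1"
    unfolding k_def using p m prime_gt_1_nat one_less_power by blast
  have n: "k = Suc n"
    using k by (simp add: n_def k_def)
  have "of_nat k = (0 :: 'a)"
    using m by (simp add: k_def)
  then have card: "card F = k"
    unfolding F_def using k by (intro card_roots_pow_eq_self)
  then have fin: "finite F"
    using k by (metis card.infinite not_one_less_zero)
  interpret field R
    unfolding R_def by (rule field_from_type_algebra)
  have R_simps: "carrier R = UNIV" "\<zero>\<^bsub>R\<^esub> = 0" "\<one>\<^bsub>R\<^esub> = 1" "x \<oplus>\<^bsub>R\<^esub> y = x + y" "x \<otimes>\<^bsub>R\<^esub> y = x * y" for x y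
    by (simp_all add: R_def ring_of_type_algebra_def)
  have neg: "\<ominus>\<^bsub>R\<^esub> x = - x" for x
    by (rule minus_equality) (simp_all add: R_simps)
  have inv: "inv\<^bsub>R\<^esub> x = inverse x" if "x \<noteq> 0" for x
    by (rule inv_char) (use that in \<open>simp_all add: R_simps\<close>)
  have add_F: "x + y \<in> F" if "x \<in> F" "y \<in> F" for x y
    using that p by (simp add: F_def freshmans_dream'[OF p k_def])
  \<comment> \<open>Additivity of the power map yields closure under negation without distinguishing
    the parity of \<open>k\<close>.\<close>
  have neg_F: "- x \<in> F" if "x \<in> F" for x
  proof -
    have "x ^ k + (- x) ^ k = (x + - x) ^ k"
      using freshmans_dream'[OF p k_def, of x "- x"] by simp
    also have "\<dots> = 0"
      using k by simp
    finally show ?thesis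
      using that by (simp add: F_def add_eq_0_iff)
  qed
  have "subfield F R"
  proof (rule subfieldI')
    show "subring F R"
      by (rule subringI) (auto simp: R_simps neg add_F neg_F, auto simp: F_def power_mult_distrib)
  qed (auto simp: R_simps inv, auto simp: F_def power_inverse)
  then interpret F: field "R\<lparr>carrier := F\<rparr>"
    by (rule subfield_iff)
  have pow: "x [^]\<^bsub>R\<lparr>carrier := F\<rparr>\<^esub> j = x ^ j" for x and j :: nat
    by (induction j) (auto simp: R_simps mult.commute)
  obtain \<alpha> where \<alpha>: "\<alpha> \<in> F - {0}" "F - {0} = {\<alpha> ^ i | i :: nat. True}"
    using F.finite_field_mult_group_has_gen fin by (auto simp: R_simps pow nat_pow_mult_of)
  have "\<alpha> ^ n * \<alpha> = \<alpha>"
    using \<alpha>(1) by (auto simp: F_def n mult.commute)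
  then have one: "\<alpha> ^ n = 1"
    using \<alpha>(1) by (metis DiffD2 mult_cancel_right1 mult.commute singletonI)
  have "n > 0"
    using k n by simp
  have "\<alpha> ^ i = \<alpha> ^ (i mod n)" for i
    by (metis div_mult_mod_eq mult_1 mult.commute one power_add power_mult power_one)
  \<comment> \<open>The first \<open>n\<close> powers exhaust a set of \<open>n\<close> elements, so
    no two of them coincide.\<close>
  then have "F - {0} = (\<lambda>j. \<alpha> ^ j) ` {..<n}"
    unfolding \<alpha>(2) using \<open>n > 0\<close> by (auto simp: image_iff) (metis lessThan_iff mod_less_divisor)
  moreover have "card (F - {0}) = n"
    using card n fin k by (subst card_Diff_singleton) (auto simp: F_def)
  ultimately have "inj_on (\<lambda>j. \<alpha> ^ j) {..<n}"
    by (intro eq_card_imp_inj_on) auto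
  with one show ?thesis
    by blast
qed

section \<open>Tools from linear algebra: Vandermonde systems and counting vectors\<close>

text \<open>This is the invertibility of a Vandermonde matrix, shown by interpolation: the
  polynomial \<open>P\<close> vanishing at every node except \<open>x j\<close> has degree below
  \<open>card S\<close>, so combining the sums with its coefficients isolates
  \<open>y j\<close>.\<close>

lemma power_sums_eq_0_imp_eq_0:
  fixes x y :: "'i \<Rightarrow> 'a :: field"
  assumes fin: "finite S" and inj: "inj_on x S"
    and sums: "\<And>i. i < card S \<Longrightarrow> (\<Sum>j\<in>S. y j * x j ^ i) = 0"
    and j: "j \<in> S"
  shows "y j = 0"
proof -
  define P where "P = (\<Prod>k\<in>S - {j}. [:- x k, 1:])"
  have "Polynomial.degree P = card (S - {j})"
    unfolding P_def by (subst degree_prod_eq_sum_degree) auto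
  then have deg: "Polynomial.degree P < card S"
    using fin j by (simp add: card_Diff_singleton) (metis card_gt_0_iff diff_less empty_iff lessI One_nat_def)
  have P0: "poly P (x k) = 0 \<longleftrightarrow> k \<noteq> j" if "k \<in> S" for k
    using that fin inj j by (auto simp: P_def poly_prod inj_on_eq_iff)
  have "(\<Sum>k\<in>S. y k * poly P (x k)) = (\<Sum>k\<in>S. \<Sum>i\<le>Polynomial.degree P. Polynomial.coeff P i * (y k * x k ^ i))"
    by (simp add: poly_altdef sum_distrib_left mult_ac)
  also have "\<dots> = (\<Sum>i\<le>Polynomial.degree P. Polynomial.coeff P i * (\<Sum>k\<in>S. y k * x k ^ i))"
    by (subst sum.swap) (simp add: sum_distrib_left)
  also have "\<dots> = 0"
    using deg by (intro sum.neutral) (auto simp: sums)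
  also have "(\<Sum>k\<in>S. y k * poly P (x k)) = (\<Sum>k\<in>{j}. y k * poly P (x k))"
    using fin j by (intro sum.mono_neutral_right) (auto simp: P0)
  finally show ?thesis
    using P0[OF j] by simp
qed

text \<open>The coefficient functions on a basis map onto the space. This direction turns a lower
  bound on the number of codewords into one on the dimension.\<close>

lemma (in vectorspace) card_carrier_le_power_dim:
  assumes finK: "finite (carrier K)" and finV: "finite (carrier V)"
  shows "card (carrier V) \<le> card (carrier K) ^ dim"
proof -
  have fd: fin_dim
    unfolding fin_dim_def using finV in_own_span[of "carrier V"] span_is_subset2[of "carrier V"] by blast
  obtain A where A: "finite A" "basis A"
    using finite_basis_exists[OF fd] by blast
  have AV: "A \<subseteq> carrier V" and gen: "span A = carrier V"
    using A(2) by (auto simp: basis_def)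
  have "carrier V \<subseteq> (\<lambda>a. lincomb a A) ` (A \<rightarrow>\<^sub>E carrier K)"
  proof
    fix v assume "v \<in> carrier V"
    then obtain a where a: "a \<in> A \<rightarrow> carrier K" "v = lincomb a A"
      using finite_in_span[OF A(1) AV] gen by blast
    \<comment> \<open>Coefficients are restricted to the basis, since arbitrary functions agreeing
      on \<open>A\<close> would be counted repeatedly.\<close>
    have "lincomb (restrict a A) A = lincomb a A"
      by (rule lincomb_cong) (use a AV in auto)
    then show "v \<in> (\<lambda>a. lincomb a A) ` (A \<rightarrow>\<^sub>E carrier K)"
      using a by (intro image_eqI[of _ _ "restrict a A"]) auto
  qed
  then have "card (carrier V) \<le> card (A \<rightarrow>\<^sub>E carrier K)"
    by (rule surj_card_le[OF finite_PiE[OF A(1)], rotated]) (use finK in auto)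
  also have "\<dots> = card (carrier K) ^ dim"
    using A by (simp add: card_PiE dim_basis)
  finally show ?thesis .
qed

section \<open>Syndromes and the interleaved code\<close>

lemma CHAR_bit: "CHAR(bit) = 2"
  by (rule CHAR_eq_posI) (auto simp: less_2_cases_iff)

lemma to_ac_bit_power: "k > 0 \<Longrightarrow> to_ac (b :: bit) ^ k = to_ac b"
  by (cases b) auto

text \<open>The entries at positions of parity \<open>s\<close> form one of the two interleaved
  words; read as a polynomial, that word is evaluated at \<open>\<alpha> ^ i\<close>. Working in the
  algebraic closure provides one ambient field for every \<open>m\<close>.\<close>

definition syndrome :: "nat \<Rightarrow> bit alg_closure \<Rightarrow> nat \<Rightarrow> nat \<Rightarrow> bit vec \<Rightarrow> bit alg_closure" where
  "syndrome n \<alpha> s i c = (\<Sum>j<n. to_ac (c $ (2 * j + s)) * \<alpha> ^ (i * j))"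

definition interleaved_bch :: "nat \<Rightarrow> nat \<Rightarrow> bit alg_closure \<Rightarrow> bit vec set" where
  "interleaved_bch n t \<alpha> =
    {c \<in> carrier_vec (2 * n). \<forall>s<2. \<forall>i\<in>{1..2*t}. syndrome n \<alpha> s i c = 0}"

lemma syndrome_diff:
  assumes "c \<in> carrier_vec (2 * n)" "d \<in> carrier_vec (2 * n)" "s < 2"
  shows "syndrome n \<alpha> s i (c - d) = syndrome n \<alpha> s i c - syndrome n \<alpha> s i d"
proof -
  have "(\<Sum>j<n. to_ac ((c - d) $ (2 * j + s)) * \<alpha> ^ (i * j)) =
    (\<Sum>j<n. to_ac (c $ (2 * j + s)) * \<alpha> ^ (i * j) - to_ac (d $ (2 * j + s)) * \<alpha> ^ (i * j))"
    using assms by (intro sum.cong refl) (simp add: left_diff_distrib del: minus_bit_def bit_0_eq)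
  then show ?thesis
    by (simp add: syndrome_def sum_subtractf)
qed

lemma syndrome_add:
  assumes "c \<in> carrier_vec (2 * n)" "d \<in> carrier_vec (2 * n)" "s < 2"
  shows "syndrome n \<alpha> s i (c + d) = syndrome n \<alpha> s i c + syndrome n \<alpha> s i d"
proof -
  have "(\<Sum>j<n. to_ac ((c + d) $ (2 * j + s)) * \<alpha> ^ (i * j)) =
    (\<Sum>j<n. to_ac (c $ (2 * j + s)) * \<alpha> ^ (i * j) + to_ac (d $ (2 * j + s)) * \<alpha> ^ (i * j))"
    using assms by (intro sum.cong refl) (simp add: distrib_right del: add_bit_eq_xor)
  then show ?thesis
    by (simp add: syndrome_def sum.distrib)
qed

lemma syndrome_zero: "s < 2 \<Longrightarrow> syndrome n \<alpha> s i (0\<^sub>v (2 * n)) = 0"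
  unfolding syndrome_def by (rule sum.neutral) auto

text \<open>Frobenius powers are additive and fix the coefficients 0 and 1, so they act only on
  \<open>\<alpha>\<close>.\<close>

lemma syndrome_power:
  "k = 2 ^ r \<Longrightarrow> syndrome n \<alpha> s i c ^ k = (\<Sum>j<n. to_ac (c $ (2 * j + s)) * (\<alpha> ^ k) ^ (i * j))"
proof -
  assume k: "k = 2 ^ r"
  have "syndrome n \<alpha> s i c ^ k = (\<Sum>j<n. (to_ac (c $ (2 * j + s)) * \<alpha> ^ (i * j)) ^ k)"
    unfolding syndrome_def by (rule freshmans_dream_sum'[of _ r]) (simp_all add: CHAR_bit k)
  also have "\<dots> = (\<Sum>j<n. to_ac (c $ (2 * j + s)) * (\<alpha> ^ k) ^ (i * j))"
    using k by (intro sum.cong) (simp_all add: power_mult_distrib to_ac_bit_power mult_ac flip: power_mult)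
  finally show ?thesis .
qed

lemma syndrome_double: "syndrome n \<alpha> s (2 * i) c = syndrome n \<alpha> s i c ^ 2"
  using syndrome_power[of 2 1 n \<alpha> s i c] by (simp add: syndrome_def mult_ac flip: power_mult)

text \<open>This confines the syndromes to the field with \<open>2 ^ m\<close> elements, which
  bounds the number of their possible values.\<close>

lemma syndrome_power_eq_self:
  "\<alpha> ^ (2 ^ m) = \<alpha> \<Longrightarrow> syndrome n \<alpha> s i c ^ (2 ^ m) = syndrome n \<alpha> s i c"
  using syndrome_power[of "2 ^ m" m n \<alpha> s i c] by (simp add: syndrome_def)

text \<open>Halving an even index repeatedly ends at an odd one, and each doubling squares the
  syndrome. Only \<open>t\<close> conditions per word remain to be counted.\<close>

lemma interleaved_bch_odd:
  "interleaved_bch n t \<alpha> =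
    {c \<in> carrier_vec (2 * n). \<forall>s<2. \<forall>i<t. syndrome n \<alpha> s (2 * i + 1) c = 0}"
proof -
  have "syndrome n \<alpha> s i c = 0"
    if "\<forall>i<t. syndrome n \<alpha> s (2 * i + 1) c = 0" "i \<in> {1..2*t}" for s i c
    using that(2)
  proof (induction i rule: less_induct)
    case (less i)
    show ?case
    proof (cases "even i")
      case True
      then obtain k where "i = 2 * k"
        by blast
      then show ?thesis
        using less by (auto simp: syndrome_double)
    next
      case False
      then obtain k where "i = 2 * k + 1"
        by (elim oddE)
      then show ?thesis
        using that(1) less.prems by auto
    qed
  qed
  moreover have "2 * i + 1 \<in> {1..2 * t}" if "i < t" for i
    using that by auto
  ultimately show ?thesis
    unfolding interleaved_bch_def by blast
qed

section \<open>Linearity and cyclicity\<close>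

lemma linear_code_interleaved_bch: "linear_code (2 * n) (interleaved_bch n t \<alpha>)"
proof -
  interpret vec_space "TYPE(bit)" "2 * n" .
  \<comment> \<open>The only scalars are 0 and 1, so just the zero word has to be checked.\<close>
  have smult: "c \<cdot>\<^sub>v v \<in> interleaved_bch n t \<alpha>"
    if "v \<in> interleaved_bch n t \<alpha>" for c and v
  proof (cases "c = 0")
    case True
    then show ?thesis
      using that by (auto simp: interleaved_bch_def syndrome_def intro!: sum.neutral)
  next
    case False
    then show ?thesis
      using that by simp
  qed
  have "submodule class_ring (interleaved_bch n t \<alpha>) V"
  proof (rule submodule.intro)
    show "Module.module class_ring V" ..
  qed (use smult in \<open>auto simp: interleaved_bch_def syndrome_add module_vec_simps syndrome_zero\<close>)
  then show ?thesis
    unfolding linear_code_def subspace_def using vectorspace_axioms by blast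
qed

text \<open>The shift moves the even word unchanged to the odd positions. The odd word moves to the
  even positions with its own cyclic shift, which multiplies its \<open>i\<close>-th syndrome by
  \<open>\<alpha> ^ i\<close>.\<close>

lemma cyclic_interleaved_bch:
  assumes "\<alpha> ^ n = 1"
  shows "cyclic (interleaved_bch n t \<alpha>)"
  unfolding cyclic_def
proof
  fix c assume c: "c \<in> interleaved_bch n t \<alpha>"
  show "cyclic_shift c \<in> interleaved_bch n t \<alpha>"
  proof (cases n)
    case 0
    then show ?thesis
      using c by (auto simp: interleaved_bch_def cyclic_shift_def syndrome_def)
  next
    case (Suc k)
    define x where "x j = to_ac (c $ (2 * j + 1))" for j
    have dim: "dim_vec c = 2 * n"
      using c by (auto simp: interleaved_bch_def)
    have odd: "syndrome n \<alpha> 1 i (cyclic_shift c) = syndrome n \<alpha> 0 i c" for i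
      unfolding syndrome_def by (intro sum.cong) (auto simp: cyclic_shift_def dim)
    have even: "syndrome n \<alpha> 0 i (cyclic_shift c) = \<alpha> ^ i * syndrome n \<alpha> 1 i c" for i
    proof -
      have \<alpha>: "\<alpha> ^ (i * n) = 1"
        using assms by (metis mult.commute power_mult power_one)
      have "syndrome n \<alpha> 0 i (cyclic_shift c) = x k + (\<Sum>j<k. x j * \<alpha> ^ (i * Suc j))"
        unfolding syndrome_def Suc sum.lessThan_Suc_shift
        by (intro arg_cong2[of _ _ _ _ "(+)"] sum.cong)
          (auto simp: cyclic_shift_def dim Suc x_def)
      \<comment> \<open>The entry that wraps around lands at exponent 0, which
        \<open>\<alpha> ^ n = 1\<close> identifies with the exponent \<open>i * n\<close> that the
        shifted sum expects.\<close>
      also have "x k = x k * \<alpha> ^ (i * Suc k)"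
        using \<alpha> Suc by simp
      also have "\<dots> + (\<Sum>j<k. x j * \<alpha> ^ (i * Suc j)) = (\<Sum>j<n. x j * \<alpha> ^ (i * Suc j))"
        by (simp add: Suc)
      also have "\<dots> = \<alpha> ^ i * syndrome n \<alpha> 1 i c"
        unfolding syndrome_def x_def by (simp add: sum_distrib_left power_add mult_ac)
      finally show ?thesis .
    qed
    have "cyclic_shift c \<in> carrier_vec (2 * n)"
      unfolding cyclic_shift_def dim by (rule vec_carrier)
    then show ?thesis
      using c odd even by (auto simp: interleaved_bch_def less_2_cases_iff)
  qed
qed

section \<open>Minimum distance\<close>

text \<open>One of the two words is nonzero. If its support had at most \<open>2 * t\<close>
  elements, the vanishing syndromes would form a Vandermonde system on that support and force its
  entries to be 0.\<close>

lemma hamming_weight_interleaved_bch: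
  assumes inj: "inj_on (\<lambda>j. \<alpha> ^ j) {..<n}" and nz: "\<alpha> \<noteq> 0"
    and c: "c \<in> interleaved_bch n t \<alpha>" "c \<noteq> 0\<^sub>v (2 * n)"
  shows "2 * t < hamming_weight c"
proof (rule ccontr)
  assume small: "\<not> 2 * t < hamming_weight c"
  have dim: "dim_vec c = 2 * n"
    using c by (auto simp: interleaved_bch_def)
  have "\<exists>l<2*n. c $ l \<noteq> 0"
    using c(2) dim by (metis carrier_vec_dim_vec eq_vecI index_zero_vec(1) index_zero_vec(2))
  then obtain l where l: "l < 2 * n" "c $ l \<noteq> 0"
    by blast
  define s where "s = l mod 2"
  define S where "S = {j. j < n \<and> c $ (2 * j + s) \<noteq> 0}"
  have s: "s < 2"
    by (simp add: s_def)
  have finS: "finite S"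
    by (simp add: S_def)
  have lS: "l div 2 \<in> S"
    using l by (auto simp: S_def s_def)
  have "card S = card ((\<lambda>j. 2 * j + s) ` S)"
    by (rule card_image[symmetric]) (simp add: inj_on_def)
  also have "\<dots> \<le> hamming_weight c"
    unfolding hamming_weight_def by (rule card_mono) (use s in \<open>auto simp: S_def dim\<close>)
  finally have cardS: "card S \<le> 2 * t"
    using small by simp
  \<comment> \<open>The zeros start at \<open>\<alpha>\<close> and not at 1, so a factor
    \<open>\<alpha> ^ j\<close> is absorbed into the unknowns; it is cancelled at the end because
    \<open>\<alpha>\<close> is nonzero.\<close>
  have "to_ac (c $ (2 * (l div 2) + s)) * \<alpha> ^ (l div 2) = 0"
  proof (rule power_sums_eq_0_imp_eq_0[OF finS _ _ lS])
    show "inj_on (\<lambda>j. \<alpha> ^ j) S"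
      by (rule inj_on_subset[OF inj]) (auto simp: S_def)
    fix i assume "i < card S"
    then have "syndrome n \<alpha> s (Suc i) c = 0"
      using c(1) s cardS by (auto simp: interleaved_bch_def)
    moreover have "syndrome n \<alpha> s (Suc i) c = (\<Sum>j\<in>S. to_ac (c $ (2 * j + s)) * \<alpha> ^ (Suc i * j))"
      unfolding syndrome_def by (rule sum.mono_neutral_right) (auto simp: S_def)
    ultimately show "(\<Sum>j\<in>S. to_ac (c $ (2 * j + s)) * \<alpha> ^ j * (\<alpha> ^ j) ^ i) = 0"
      by (simp add: power_add mult_ac flip: power_mult)
  qed
  then show False
    using l nz by (simp add: s_def)
qed

section \<open>Counting codewords\<close>

lemma UNIV_bit: "(UNIV :: bit set) = {0, 1}"
  by (auto intro: bit.exhaust)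

lemma finite_bit: "finite (UNIV :: bit set)"
  unfolding UNIV_bit by simp

lemma card_UNIV_bit: "card (UNIV :: bit set) = 2"
  unfolding UNIV_bit by (simp only: card_2_iff') auto

lemma card_carrier_vec_bit:
  "finite (carrier_vec N :: bit vec set)" "card (carrier_vec N :: bit vec set) = 2 ^ N"
proof -
  have bij: "bij_betw (vec N) ({..<N} \<rightarrow>\<^sub>E (UNIV :: bit set)) (carrier_vec N)"
    by (rule bij_betw_byWitness[where f' = "\<lambda>v. restrict (vec_index v) {..<N}"])
      (auto simp: fun_eq_iff PiE_def extensional_def)
  show "finite (carrier_vec N :: bit vec set)"
    using bij_betw_finite[OF bij] by (simp add: finite_PiE finite_bit)
  show "card (carrier_vec N :: bit vec set) = 2 ^ N"
    using bij_betw_same_card[OF bij] by (simp add: card_PiE card_UNIV_bit)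
qed

text \<open>The map \<open>\<phi>\<close> to the odd syndromes takes at most
  \<open>(2 ^ m) ^ (2 * t)\<close> values, and each fiber is no larger than the code. Counting
  avoids comparing dimensions over two different fields.\<close>

lemma card_interleaved_bch:
  assumes \<alpha>: "\<alpha> ^ (2 ^ m) = \<alpha>" and m: "m > 0"
  shows "2 ^ (2 * n) \<le> card (interleaved_bch n t \<alpha>) * 2 ^ (2 * m * t)"
proof -
  define F where "F = {x :: bit alg_closure. x ^ (2 ^ m) = x}"
  define I where "I = {..<2 :: nat} \<times> {..<t}"
  define \<phi> where "\<phi> c = restrict (\<lambda>(s, i). syndrome n \<alpha> s (2 * i + 1) c) I" for c
  let ?V = "carrier_vec (2 * n) :: bit vec set"
  have finI: "finite I" and cardI: "card I = 2 * t"
    by (simp_all add: I_def)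
  have "card F = 2 ^ m"
    unfolding F_def using m
    by (intro card_roots_pow_eq_self) (simp_all add: CHAR_bit of_nat_eq_0_iff_char_dvd one_less_power del: of_nat_power One_nat_def)
  then have finF: "finite F" and cardF: "card F = 2 ^ m"
    by (auto intro: card_ge_0_finite)
  have finB: "finite (interleaved_bch n t \<alpha>)"
    by (rule finite_subset[OF _ card_carrier_vec_bit(1)[of "2 * n"]]) (auto simp: interleaved_bch_def)
  have fiber: "card {c \<in> ?V. \<phi> c = y} \<le> card (interleaved_bch n t \<alpha>)" for y
  proof (cases "{c \<in> ?V. \<phi> c = y} = {}")
    case False
    then obtain d where d: "d \<in> ?V" "\<phi> d = y"
      by blast
    \<comment> \<open>Translation by one member of the fiber embeds the fiber into the kernel of the
      syndromes.\<close>
    have "(\<lambda>c. c - d) ` {c \<in> ?V. \<phi> c = y} \<subseteq> interleaved_bch n t \<alpha>"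
    proof
      fix v assume "v \<in> (\<lambda>c. c - d) ` {c \<in> ?V. \<phi> c = y}"
      then obtain c where c: "c \<in> ?V" "\<phi> c = \<phi> d" "v = c - d"
        using d by auto
      have "syndrome n \<alpha> s (2 * i + 1) c = syndrome n \<alpha> s (2 * i + 1) d" if "s < 2" "i < t" for s i
        using fun_cong[OF c(2), of "(s, i)"] that by (simp add: \<phi>_def I_def)
      then show "v \<in> interleaved_bch n t \<alpha>"
        using c d by (auto simp: interleaved_bch_odd syndrome_diff)
    qed
    moreover have "inj_on (\<lambda>c. c - d) {c \<in> ?V. \<phi> c = y}"
    proof (rule inj_onI)
      fix a b assume ab: "a \<in> {c \<in> ?V. \<phi> c = y}" "b \<in> {c \<in> ?V. \<phi> c = y}" "a - d = b - d"
      show "a = b"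
      proof (rule eq_vecI)
        fix i assume i: "i < dim_vec b"
        have "i < dim_vec d"
          using ab(2) d(1) i by auto
        then have "a $ i - d $ i = b $ i - d $ i"
          using ab(3) by (metis index_minus_vec(1))
        then show "a $ i = b $ i"
          by (metis diff_add_cancel)
      qed (use ab in auto)
    qed
    ultimately show ?thesis
      using finB by (intro card_inj_on_le)
  next
    case True
    show ?thesis
      unfolding True by simp
  qed
  have "\<phi> ` ?V \<subseteq> I \<rightarrow>\<^sub>E F"
    using syndrome_power_eq_self[OF \<alpha>] by (auto simp: \<phi>_def F_def PiE_def)
  then have "card (\<phi> ` ?V) \<le> card (I \<rightarrow>\<^sub>E F)"
    using finI finF by (intro card_mono finite_PiE) auto
  also have "card (I \<rightarrow>\<^sub>E F) = (2 ^ m) ^ (2 * t)"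
    unfolding card_PiE[OF finI] cardF using cardI by simp
  finally have img: "card (\<phi> ` ?V) \<le> (2 ^ m) ^ (2 * t)" .
  have "2 ^ (2 * n) = card ?V"
    unfolding card_carrier_vec_bit ..
  also have "card ?V = (\<Sum>y\<in>\<phi> ` ?V. card {c \<in> ?V. \<phi> c = y})"
    using sum.image_gen[OF card_carrier_vec_bit(1), of "\<lambda>_. 1 :: nat" "2 * n" \<phi>] by simp
  also have "\<dots> \<le> card (\<phi> ` ?V) * card (interleaved_bch n t \<alpha>)"
    using sum_bounded_above[OF fiber] by simp
  also have "\<dots> \<le> (2 ^ m) ^ (2 * t) * card (interleaved_bch n t \<alpha>)"
    using img by (rule mult_le_mono1)
  also have "\<dots> = card (interleaved_bch n t \<alpha>) * 2 ^ (2 * m * t)"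
    unfolding power_mult[symmetric] by (simp add: mult_ac)
  finally show ?thesis .
qed

lemma card_le_power_code_dim:
  assumes "linear_code N B"
  shows "card B \<le> 2 ^ code_dim N B"
proof -
  interpret vec_space "TYPE(bit)" N .
  have sub: "VectorSpace.subspace class_ring B V"
    using assms by (simp add: linear_code_def)
  have BV: "B \<subseteq> carrier_vec N"
    using submodule.subset[OF subspace.submod[OF sub]] by simp
  have "finite B"
    using BV card_carrier_vec_bit(1) by (rule finite_subset)
  then show ?thesis
    using vectorspace.card_carrier_le_power_dim[OF subspace_is_vs[OF sub]]
    by (simp add: code_dim_def card_UNIV_bit finite_bit del: add_bit_eq_xor mult_bit_eq_and)
qed

section \<open>Numerical estimates and the final parameters\<close>

text \<open>The base case is 820 <= 1024, and at \<open>m = 9\<close> the inequality fails. In the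
  induction step doubling beats the quadratic growth because 10 m <= m^2.\<close>

lemma power_two_ge_quadratic: "m \<ge> 10 \<Longrightarrow> 8 * m ^ 2 + 2 * m \<le> 2 ^ m" for m :: nat
proof (induction m rule: dec_induct)
  case (step m)
  have "10 * m \<le> m * m"
    using step.hyps(1) by (rule mult_le_mono1)
  moreover have "8 * (Suc m)\<^sup>2 + 2 * Suc m = 8 * (m * m) + 18 * m + 10"
    by (simp add: power2_eq_square)
  ultimately show ?case
    using step.IH step.hyps(1) unfolding power2_eq_square power_Suc by linarith
qed simp

theorem theorem4:
  fixes m q :: nat
  assumes "m \<ge> 10"
    and "primepow q"
    and "q + 1 = 2 ^ (m + 1) - 2"
  shows "\<exists>B :: bit vec set. linear_code (q + 1) B \<and> cyclic B \<and>
    rate (q + 1) B > 1 / 2 \<and>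
    normalized_distance (q + 1) B > 2 * sqrt (real q) / (real q + 1)"
proof -
  define n :: nat where "n = 2 ^ m - 1"
  \<comment> \<open>This is the largest \<open>t\<close> with 2 m t <= n - 1; the inner
    \<open>- 1\<close> keeps the dimension strictly above \<open>n\<close>.\<close>
  define t :: nat where "t = (2 ^ (m - 1) - 1) div m"
  have pow: "2 ^ m = (2 * 2 ^ (m - 1) :: nat)"
    using assms(1) by (cases m) auto
  have n: "q + 1 = 2 * n" "2 ^ m = Suc n"
    using assms(3) by (simp_all add: n_def)
  have mt: "2 * m * t + 1 \<le> n"
  proof -
    have "m * t \<le> 2 ^ (m - 1) - 1"
      unfolding t_def by simp
    moreover have "(1::nat) \<le> 2 ^ (m - 1)"
      by simp
    ultimately show ?thesis
      unfolding n_def pow by linarith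
  qed
  have large: "4 * q < (2 * t + 1) ^ 2"
  proof -
    \<comment> \<open>Maximality of \<open>t\<close> bounds it from below; after doubling, the
      designed distance 2 t + 1 appears.\<close>
    have "2 ^ (m - 1) - 1 < m * (t + 1)"
      unfolding t_def using assms(1) by (simp add: dividend_less_times_div)
    then have le: "2 ^ m \<le> m * (2 * t + 1) + m"
      unfolding pow by (simp add: algebra_simps)
    \<comment> \<open>Integers are used because the differences below would be truncated on
      naturals.\<close>
    define N :: int where "N = 2 ^ m"
    define u :: int where "u = 2 * int t + 1"
    have N: "N - int m \<le> int m * u"
      using of_nat_mono[OF le, where ?'a = int] unfolding N_def u_def by (simp add: algebra_simps)
    have quad: "8 * (int m)\<^sup>2 + 2 * int m \<le> N"
      using of_nat_mono[OF power_two_ge_quadratic[OF assms(1)], where ?'a = int]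
      unfolding N_def by simp
    \<comment> \<open>The product (N - 2 m) N falls short of (N - m)^2 by exactly m^2. Cancelling
      m^2 at the end of the chain gives 8 N <= u^2, while 4 q = 8 N - 12.\<close>
    have "8 * (int m)\<^sup>2 * N \<le> (N - 2 * int m) * N"
      using quad by (intro mult_right_mono) (auto simp: N_def)
    also have "\<dots> \<le> (N - int m)\<^sup>2"
      by (simp add: power2_eq_square algebra_simps)
    also have "\<dots> \<le> (int m * u)\<^sup>2"
      using N quad by (intro power_mono) (auto intro: order_trans[rotated])
    finally have "(int m)\<^sup>2 * (8 * N) \<le> (int m)\<^sup>2 * u\<^sup>2"
      by (simp add: power_mult_distrib mult_ac)
    then have "8 * N \<le> u\<^sup>2"
      using assms(1) by simp
    moreover have "N = int n + 1"
      using arg_cong[OF n(2), of int] by (simp add: N_def)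
    ultimately have "4 * int q < (2 * int t + 1)\<^sup>2"
      using n(1) unfolding u_def by linarith
    then have "int (4 * q) < int ((2 * t + 1)\<^sup>2)"
      by (simp add: add_ac)
    then show ?thesis
      by (simp only: of_nat_less_iff)
  qed
  have "prime CHAR(bit alg_closure)"
    by (simp add: CHAR_bit)
  from ex_primitive_element[OF this, of m] obtain \<alpha> :: "bit alg_closure"
    where \<alpha>: "\<alpha> ^ n = 1" "inj_on (\<lambda>j. \<alpha> ^ j) {..<n}"
    using assms(1) by (auto simp: CHAR_bit n_def)
  have \<alpha>0: "\<alpha> \<noteq> 0"
    using \<alpha>(1) mt by (auto simp: power_0_left split: if_splits)
  define B where "B = interleaved_bch n t \<alpha>"
  have lin: "linear_code (2 * n) B"
    unfolding B_def by (rule linear_code_interleaved_bch)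
  have card_B: "2 ^ (2 * n) \<le> card B * 2 ^ (2 * m * t)"
    unfolding B_def using \<alpha>(1) n assms(1) by (intro card_interleaved_bch) auto
  also have "card B * 2 ^ (2 * m * t) \<le> 2 ^ code_dim (2 * n) B * 2 ^ (2 * m * t)"
    using card_le_power_code_dim[OF lin] by simp
  finally have "(2::nat) ^ (2 * n) \<le> 2 ^ (code_dim (2 * n) B + 2 * m * t)"
    by (simp add: power_add)
  then have "2 * n \<le> code_dim (2 * n) B + 2 * m * t"
    by simp
  then have dim: "n < code_dim (2 * n) B"
    using mt by linarith
  have finB: "finite B"
    by (rule finite_subset[OF _ card_carrier_vec_bit(1)[of "2 * n"]]) (auto simp: B_def interleaved_bch_def)
  \<comment> \<open>A nonzero codeword ensures that \<open>Min\<close> is taken over a nonempty set.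
    Without one, the count of codewords would give 2 n <= 2 m t.\<close>
  have "B - {0\<^sub>v (2 * n)} \<noteq> {}"
  proof
    assume "B - {0\<^sub>v (2 * n)} = {}"
    then have "card B \<le> card {0\<^sub>v (2 * n) :: bit vec}"
      by (intro card_mono) auto
    then have "card B * 2 ^ (2 * m * t) \<le> 1 * 2 ^ (2 * m * t)"
      by (intro mult_le_mono1) simp
    with card_B have "(2::nat) ^ (2 * n) \<le> 2 ^ (2 * m * t)"
      by linarith
    then show False
      using mt by simp
  qed
  then have "min_distance (2 * n) B \<in> hamming_weight ` (B - {0\<^sub>v (2 * n)})"
    unfolding min_distance_def using finB by (intro Min_in) auto
  then have dist: "2 * t + 1 \<le> min_distance (2 * n) B"
    using hamming_weight_interleaved_bch[OF \<alpha>(2) \<alpha>0] by (fastforce simp: B_def)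
  have "real (4 * q) < real ((2 * t + 1) ^ 2)"
    using large by (rule less_imp_of_nat_less)
  then have "sqrt (4 * real q) < 2 * real t + 1"
    by (intro real_less_lsqrt) (auto simp: add_ac)
  then have "2 * sqrt (real q) < real (min_distance (2 * n) B)"
    using dist by (simp add: real_sqrt_mult)
  then have "normalized_distance (q + 1) B > 2 * sqrt (real q) / (real q + 1)"
    unfolding normalized_distance_def n(1)[symmetric] by (simp add: divide_strict_right_mono add_ac)
  moreover have "rate (q + 1) B > 1 / 2"
    using dim mt unfolding rate_def n(1) by (simp add: field_simps)
  moreover have "cyclic B"
    unfolding B_def by (rule cyclic_interleaved_bch[OF \<alpha>(1)])
  ultimately show ?thesis
    using lin n(1) by metis
qed

end
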